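(* Let $\gamma_1=\frac{\sqrt{17}-3}{2}$. There is an absolute constant $C>0$ such that for every $\varepsilon>0$, every positive integer $N$, and every trigonometric polynomial $f$ with frequencies in the set $\{n^3: n\in\mathbb{Z},\ N\leq n\leq N+N^{\gamma_1-\varepsilon}\}$, we have $$\|f\|_4\leq C\,\varepsilon^{-1/4}\|f\|_2 .$$
   Context: A trigonometric polynomial $f$ has frequencies in a finite set $A\subseteq\mathbb{Z}$ if $f(x)=\sum_{n\in A}a_ne(nx)$ with $a_n\in\mathbb{C}$, where $e(x)=e^{2\pi i x}$. For $p\geq 1$, $\|f\|_p=\left(\int_{\mathbb{T}}|f(x)|^p\,dx\right)^{1/p}$ with $\mathbb{T}=\mathbb{R}/\mathbb{Z}$.
   Formalization: The inequality is proved for 0 < ε ≤ 1 rather than every ε > 0: for unbounded ε no absolute C works, since f(x) = e(N³x) has both norms equal to 1 while Cε^{-1/4} tends to 0. *)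

theory Defs
  imports "HOL-Analysis.Analysis"
begin

definition gamma1 :: real where
  "gamma1 = (sqrt 17 - 3) / 2"

definition unit_exp :: "real \<Rightarrow> complex" where
  "unit_exp x = exp (2 * complex_of_real pi * \<i> * complex_of_real x)"

(* Functions on R/Z are represented by their 1-periodic lifts to the reals. *)
definition trig_poly_on :: "int set \<Rightarrow> (real \<Rightarrow> complex) \<Rightarrow> bool" where
  "trig_poly_on A f \<longleftrightarrow>
     finite A \<and>
     (\<exists>a :: int \<Rightarrow> complex. \<forall>x. f x = (\<Sum>n\<in>A. a n * unit_exp (real_of_int n * x)))"

(* The normalised measure on R/Z is Lebesgue measure on the fundamental domain [0,1];
   intended for p >= 1 and 1-periodic f. *)
definition Lp_norm_circle :: "real \<Rightarrow> (real \<Rightarrow> complex) \<Rightarrow> real" where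
  "Lp_norm_circle p f = (LBINT x:{0..1}. norm (f x) powr p) powr (1 / p)"

definition short_cubes :: "nat \<Rightarrow> real \<Rightarrow> int set" where
  "short_cubes N \<epsilon> =
     {n ^ 3 | n :: int. real N \<le> real_of_int n \<and>
                        real_of_int n \<le> real N + real N powr (gamma1 - \<epsilon>)}"

end

theory Submission
  imports Defs
begin

(* If a^3 + b^3 = m, then s = a + b divides 4 m = s^3 + 3 s (a - b)^2. For a, b in [N, N + h] the
   term (a - b)^2 is so small that all admissible s lie in an interval of length h^2 / (2 N).
   Four distinct divisors of 4 m with pairwise gaps at most L satisfy
   s1 s2 s3 s4 \<le> 4 m * L^6, which is impossible once h^12 \<le> N^7; this covers
   h = N powr gamma1 because gamma1 < 7/12. Hence m has at most six representations, and
   Parseval for f^2 together with Cauchy-Schwarz bounds the L4 norm, uniformly in \<epsilon>. *)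

section \<open>The fourth moment of a trigonometric polynomial\<close>

lemma unit_exp_0 [simp]: "unit_exp 0 = 1"
  by (simp add: unit_exp_def)

lemma unit_exp_add: "unit_exp (x + y) = unit_exp x * unit_exp y"
  by (simp add: unit_exp_def exp_add [symmetric] algebra_simps)

lemma cnj_unit_exp: "cnj (unit_exp x) = unit_exp (- x)"
  by (simp add: unit_exp_def exp_cnj)

lemma unit_exp_of_int: "unit_exp (of_int k) = 1"
proof -
  have "unit_exp (of_int k) = exp (2 * of_int k * of_real pi * \<i>)"
    by (simp add: unit_exp_def mult_ac)
  then show ?thesis
    using exp_integer_2pi [of "of_int k"] by (simp add: mult_ac)
qed

lemma continuous_on_unit_exp [continuous_intros]:
  "continuous_on S g \<Longrightarrow> continuous_on S (\<lambda>x. unit_exp (g x))"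
  unfolding unit_exp_def by (intro continuous_intros)

lemma has_integral_unit_exp:
  "((\<lambda>x. unit_exp (of_int k * x)) has_integral (if k = 0 then 1 else 0)) {0..1}"
proof (cases "k = 0")
  case True
  then show ?thesis
    using has_integral_const_real [of "1 :: complex" 0 1] by simp
next
  case False
  define w where "w = 2 * complex_of_real pi * \<i> * of_int k"
  have w: "w \<noteq> 0" using False by (simp add: w_def)
  have e: "unit_exp (of_int k * x) = exp (w * of_real x)" for x
    by (simp add: unit_exp_def w_def mult_ac)
  have "((\<lambda>x. exp (w * of_real x) / w) has_vector_derivative exp (w * of_real x))
          (at x within {0..1})" for x
    by (rule has_vector_derivative_real_field)
       (use w in \<open>auto intro!: derivative_eq_intros\<close>)
  then have "((\<lambda>x. exp (w * of_real x)) has_integral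
      exp (w * of_real 1) / w - exp (w * of_real 0) / w) {0..1}"
    by (intro fundamental_theorem_of_calculus) auto
  \<comment> \<open>Since \<open>w\<close> is a nonzero integer multiple of 2 pi i, the
    antiderivative takes the same value at both endpoints.\<close>
  moreover have "exp (w * of_real 1) = 1"
    using e [of 1] unit_exp_of_int [of k] by simp
  ultimately show ?thesis
    using False by (simp add: e)
qed

text \<open>Expanding the squared norm as \<open>f x * cnj (f x)\<close> gives a double sum of
  exponentials; integrating termwise, orthogonality leaves the diagonal.\<close>

lemma parseval_trig_poly:
  fixes b :: "int \<Rightarrow> complex"
  assumes "finite B"
  shows "(LBINT x:{0..1}. norm (\<Sum>n\<in>B. b n * unit_exp (of_int n * x)) ^ 2)
           = (\<Sum>n\<in>B. norm (b n) ^ 2)"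
proof -
  define f where "f x = (\<Sum>n\<in>B. b n * unit_exp (of_int n * x))" for x
  have sq: "complex_of_real (norm (f x) ^ 2)
      = (\<Sum>n\<in>B. \<Sum>m\<in>B. b n * cnj (b m) * unit_exp (of_int (n - m) * x))" for x
  proof -
    have "complex_of_real (norm (f x) ^ 2) = f x * cnj (f x)"
      by (simp only: complex_norm_square)
    also have "\<dots> = (\<Sum>n\<in>B. \<Sum>m\<in>B.
        b n * unit_exp (of_int n * x) * (cnj (b m) * unit_exp (- (of_int m * x))))"
      by (simp add: f_def cnj_unit_exp sum_product)
    also have "\<dots> = (\<Sum>n\<in>B. \<Sum>m\<in>B. b n * cnj (b m) * unit_exp (of_int (n - m) * x))"
    proof (intro sum.cong refl)
      fix n m
      have "unit_exp (of_int (n - m) * x) = unit_exp (of_int n * x) * unit_exp (- (of_int m * x))"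
        by (simp add: unit_exp_add [symmetric] algebra_simps)
      then show "b n * unit_exp (of_int n * x) * (cnj (b m) * unit_exp (- (of_int m * x)))
          = b n * cnj (b m) * unit_exp (of_int (n - m) * x)"
        by simp
    qed
    finally show ?thesis .
  qed
  have "((\<lambda>x. complex_of_real (norm (f x) ^ 2)) has_integral
      (\<Sum>n\<in>B. \<Sum>m\<in>B. b n * cnj (b m) * (if n - m = 0 then 1 else 0))) {0..1}"
    unfolding sq
    by (intro has_integral_sum assms has_integral_mult_right has_integral_unit_exp)
  also have "(\<Sum>n\<in>B. \<Sum>m\<in>B. b n * cnj (b m) * (if n - m = 0 then 1 else 0))
      = (\<Sum>n\<in>B. b n * cnj (b n))"
    using assms by (intro sum.cong refl) (simp add: if_distrib cong: if_cong)
  also have "\<dots> = complex_of_real (\<Sum>n\<in>B. norm (b n) ^ 2)"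
    by (simp add: complex_norm_square [symmetric])
  finally have of_real: "((\<lambda>x. complex_of_real (norm (f x) ^ 2)) has_integral
      complex_of_real (\<Sum>n\<in>B. norm (b n) ^ 2)) {0..1}" .
  have "((\<lambda>x. norm (f x) ^ 2) has_integral (\<Sum>n\<in>B. norm (b n) ^ 2)) {0..1}"
    using has_integral_linear [OF of_real bounded_linear_Re]
    by (simp only: o_def Re_complex_of_real)
  \<comment> \<open>Continuity identifies the gauge integral computed above with the Lebesgue
    integral of the statement.\<close>
  moreover have "set_integrable lborel {0..1} (\<lambda>x. norm (f x) ^ 2)"
    unfolding f_def
    by (intro borel_integrable_atLeastAtMost' continuous_intros)
  ultimately show ?thesis
    by (simp add: f_def [symmetric] set_borel_integral_eq_integral integral_unique)
qed

lemma norm_sum_square_le_card: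
  fixes z :: "'a \<Rightarrow> 'b::real_normed_vector"
  shows "norm (\<Sum>p\<in>P. z p) ^ 2 \<le> real (card P) * (\<Sum>p\<in>P. norm (z p) ^ 2)"
proof -
  have "norm (\<Sum>p\<in>P. z p) ^ 2 \<le> (\<Sum>p\<in>P. 1 * norm (z p)) ^ 2"
    by (intro power_mono) (simp_all add: norm_sum)
  also have "\<dots> \<le> (\<Sum>p\<in>P. 1\<^sup>2) * (\<Sum>p\<in>P. norm (z p) ^ 2)"
    by (rule Cauchy_Schwarz_ineq_sum)
  finally show ?thesis by simp
qed

text \<open>The fourth power of the L4 norm is the squared L2 norm of \<open>f ^ 2\<close>, whose
  coefficient \<open>c m\<close> is a sum over at most \<open>K\<close> pairs. Cauchy-Schwarz on
  each \<open>c m\<close> costs a factor \<open>K\<close>; the fibres \<open>R m\<close> partition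
  \<open>A \<times> A\<close>, and the remaining sum over all pairs factors as
  \<open>S ^ 2\<close>.\<close>

lemma L4_le_L2_of_representation_bound:
  fixes A :: "int set"
  assumes f: "trig_poly_on A f"
    and reps: "\<And>m. card {(u, v) \<in> A \<times> A. u + v = m} \<le> K"
  shows "Lp_norm_circle 4 f \<le> real K powr (1/4) * Lp_norm_circle 2 f"
proof -
  obtain a where A: "finite A"
    and fa: "\<And>x. f x = (\<Sum>n\<in>A. a n * unit_exp (of_int n * x))"
    using f unfolding trig_poly_on_def by blast
  define \<sigma> :: "int \<times> int \<Rightarrow> int" where "\<sigma> = (\<lambda>(u, v). u + v)"
  define z where "z = (\<lambda>(u, v). a u * a v)"
  define R where "R m = {p \<in> A \<times> A. \<sigma> p = m}" for m
  define c where "c m = (\<Sum>p\<in>R m. z p)" for m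
  define S where "S = (\<Sum>n\<in>A. norm (a n) ^ 2)"
  have S0: "S \<ge> 0" by (simp add: S_def sum_nonneg)
  have AA: "finite (A \<times> A)" using A by simp
  have f2: "f x ^ 2 = (\<Sum>m\<in>\<sigma> ` (A \<times> A). c m * unit_exp (of_int m * x))" for x
  proof -
    have "f x ^ 2 = (\<Sum>u\<in>A. \<Sum>v\<in>A. a u * unit_exp (of_int u * x) * (a v * unit_exp (of_int v * x)))"
      by (simp add: fa power2_eq_square sum_product)
    also have "\<dots> = (\<Sum>p\<in>A \<times> A. z p * unit_exp (of_int (\<sigma> p) * x))"
      by (simp add: sum.cartesian_product z_def \<sigma>_def case_prod_unfold unit_exp_add
          algebra_simps)
    also have "\<dots> = (\<Sum>m\<in>\<sigma> ` (A \<times> A). \<Sum>p\<in>R m. z p * unit_exp (of_int (\<sigma> p) * x))"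
      unfolding R_def by (rule sum.image_gen [OF AA])
    also have "\<dots> = (\<Sum>m\<in>\<sigma> ` (A \<times> A). c m * unit_exp (of_int m * x))"
      by (simp add: c_def R_def sum_distrib_right)
    finally show ?thesis .
  qed
  have L2: "Lp_norm_circle 2 f = S powr (1/2)"
    using parseval_trig_poly [OF A, of a] by (simp add: Lp_norm_circle_def fa S_def)
  have "norm (f x) powr 4 = norm (f x ^ 2) ^ 2" for x
    by (simp add: norm_power flip: power_mult)
  then have L4: "Lp_norm_circle 4 f = (\<Sum>m\<in>\<sigma> ` (A \<times> A). norm (c m) ^ 2) powr (1/4)"
    using parseval_trig_poly [of "\<sigma> ` (A \<times> A)" c] AA by (simp add: Lp_norm_circle_def f2)
  have "(\<Sum>m\<in>\<sigma> ` (A \<times> A). norm (c m) ^ 2)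
      \<le> (\<Sum>m\<in>\<sigma> ` (A \<times> A). real K * (\<Sum>p\<in>R m. norm (z p) ^ 2))"
  proof (intro sum_mono)
    fix m
    have "card (R m) \<le> K"
      using reps [of m] by (simp add: R_def \<sigma>_def case_prod_unfold mem_Times_iff)
    then have "real (card (R m)) * (\<Sum>p\<in>R m. norm (z p) ^ 2)
        \<le> real K * (\<Sum>p\<in>R m. norm (z p) ^ 2)"
      by (intro mult_right_mono sum_nonneg) auto
    then show "norm (c m) ^ 2 \<le> real K * (\<Sum>p\<in>R m. norm (z p) ^ 2)"
      unfolding c_def using norm_sum_square_le_card [of z "R m"] by linarith
  qed
  also have "\<dots> = real K * (\<Sum>p\<in>A \<times> A. norm (z p) ^ 2)"
    unfolding R_def by (simp add: sum_distrib_left [symmetric] sum.image_gen [OF AA, of _ \<sigma>])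
  also have "(\<Sum>p\<in>A \<times> A. norm (z p) ^ 2) = S ^ 2"
    by (simp add: S_def power2_eq_square [of "sum _ _"] sum_product sum.cartesian_product z_def
        case_prod_unfold norm_mult power_mult_distrib)
  finally have "Lp_norm_circle 4 f \<le> (real K * S ^ 2) powr (1/4)"
    unfolding L4 by (intro powr_mono2 sum_nonneg) auto
  also have "S ^ 2 = S powr 2"
    using S0 by simp
  also have "(real K * S powr 2) powr (1/4) = real K powr (1/4) * S powr (1/2)"
    using S0 by (simp add: powr_mult powr_powr del: powr_numeral)
  finally show ?thesis by (simp add: L2)
qed

section \<open>Representations as sums of two cubes from a short interval\<close>

lemma gcd_mult_dvd_mult_gcd:
  fixes a b c :: "'a::semiring_gcd"
  shows "gcd (a * b) c dvd gcd a c * gcd b c"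
proof -
  have "gcd (a * b) c dvd gcd (a * b) (a * c)" by simp
  then have "gcd (a * b) c dvd a * gcd b c" by (simp add: gcd_mult_left)
  \<comment> \<open>The left side divides \<open>c\<close>, hence also \<open>c * gcd b c\<close>;
    the common factor \<open>gcd b c\<close> then comes out of the right side.\<close>
  then have "gcd (a * b) c dvd gcd (a * gcd b c) (c * gcd b c)" by simp
  then show ?thesis by (simp add: gcd_mult_right gcd.commute)
qed

text \<open>Induction step for multiplying divisors of \<open>M\<close>: \<open>g\<close> is the
  correction accumulated so far, and one more divisor \<open>c\<close> enlarges it by
  \<open>gcd x c\<close>.\<close>

lemma mult_dvd_mult_gcd:
  fixes M x c g :: int
  assumes "x dvd M * g" "c dvd M"
  shows "x * c dvd M * (g * gcd x c)"
proof -
  have "lcm x c dvd M * g" using assms by simp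
  then have "lcm x c * gcd x c dvd (M * g) * gcd x c" by (rule mult_dvd_mono) simp
  \<comment> \<open>Over the integers the two sides agree only up to sign, hence divisibility
    instead of equality.\<close>
  moreover have "x * c dvd lcm x c * gcd x c" by (subst lcm_mult_gcd) (intro mult_dvd_mono; simp)
  ultimately show ?thesis by (metis dvd_trans mult.assoc)
qed

text \<open>The divisors are multiplied in one at a time; each new one costs its gcd with the
  product of the earlier ones, which splits into pairwise gcds.\<close>

lemma four_divisors_dvd:
  fixes M a b c d :: int
  assumes "a dvd M" "b dvd M" "c dvd M" "d dvd M"
  shows "a * b * c * d dvd
    M * (gcd a b * (gcd a c * gcd b c) * (gcd a d * gcd b d * gcd c d))"
proof -
  have 1: "a * b dvd M * gcd a b"
    using mult_dvd_mult_gcd [of a M 1 b] assms by simp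
  have 2: "a * b * c dvd M * (gcd a b * (gcd a c * gcd b c))"
    using mult_dvd_mult_gcd [OF 1 \<open>c dvd M\<close>] gcd_mult_dvd_mult_gcd [of a b c]
    by (meson dvd_refl dvd_trans mult_dvd_mono)
  have "gcd (a * b * c) d dvd gcd a d * gcd b d * gcd c d"
    using gcd_mult_dvd_mult_gcd [of "a * b" c d] gcd_mult_dvd_mult_gcd [of a b d]
    by (meson dvd_refl dvd_trans mult_dvd_mono)
  then show ?thesis
    using mult_dvd_mult_gcd [OF 2 \<open>d dvd M\<close>]
    by (meson dvd_refl dvd_trans mult_dvd_mono)
qed

lemma gcd_le_abs_diff:
  fixes a b :: int
  assumes "a \<noteq> b"
  shows "gcd a b \<le> \<bar>a - b\<bar>"
  using assms by (intro zdvd_imp_le) (auto intro: dvd_diff)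

text \<open>The gcd of two distinct integers divides their difference, so it is at most
  \<open>L\<close>; the exponent 6 counts the pairs among four divisors.\<close>

lemma four_divisors_close_bound:
  fixes M a b c d :: int and L :: real
  assumes dvd: "a dvd M" "b dvd M" "c dvd M" "d dvd M" and "M > 0"
    and pos: "a > 0" "b > 0" "c > 0" "d > 0"
    and dist: "distinct [a, b, c, d]"
    and close: "\<And>x y. x \<in> {a, b, c, d} \<Longrightarrow> y \<in> {a, b, c, d} \<Longrightarrow> \<bar>real_of_int x - y\<bar> \<le> L"
  shows "real_of_int (a * b * c * d) \<le> M * L ^ 6"
proof -
  have g: "real_of_int (gcd x y) \<le> L"
    if "x \<in> {a, b, c, d}" "y \<in> {a, b, c, d}" "x \<noteq> y" for x y
  proof -
    have "real_of_int (gcd x y) \<le> real_of_int \<bar>x - y\<bar>"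
      using gcd_le_abs_diff [OF \<open>x \<noteq> y\<close>] by linarith
    then show ?thesis using close [OF that(1,2)] by simp
  qed
  have L0: "L \<ge> 0" using close [of a a] by simp
  have "a * b * c * d \<le> M * (gcd a b * (gcd a c * gcd b c) * (gcd a d * gcd b d * gcd c d))"
    using pos \<open>M > 0\<close> by (intro zdvd_imp_le four_divisors_dvd dvd) (simp add: zero_less_mult_iff)
  then have "real_of_int (a * b * c * d)
      \<le> real_of_int (M * (gcd a b * (gcd a c * gcd b c) * (gcd a d * gcd b d * gcd c d)))"
    by (simp only: of_int_le_iff)
  also have "\<dots> = real_of_int M * (real_of_int (gcd a b) *
      (real_of_int (gcd a c) * real_of_int (gcd b c)) *
      (real_of_int (gcd a d) * real_of_int (gcd b d) * real_of_int (gcd c d)))"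
    by (simp only: of_int_mult)
  also have "\<dots> \<le> M * (L * (L * L) * (L * L * L))"
    using dist \<open>M > 0\<close> L0 by (intro mult_left_mono mult_mono g) auto
  also have "\<dots> = M * L ^ 6" by (simp add: power_numeral_reduce)
  finally show ?thesis .
qed

section \<open>Pairs with equal sums of cubes\<close>

lemma cube_sum_by_sum_and_difference:
  fixes a b :: "'a::comm_ring_1"
  shows "4 * (a ^ 3 + b ^ 3) = (a + b) ^ 3 + 3 * (a + b) * (a - b)\<^sup>2"
  by (simp add: power2_eq_square power3_eq_cube algebra_simps)

text \<open>Let \<open>s \<le> t\<close> be the two sums. By the identity for four times a sum of
  cubes, \<open>t ^ 3 - s ^ 3\<close> is at most 3 s (a - b)^2, hence at most 3 s h^2. It is also at
  least 3 s^2 (t - s), so (t - s) s is at most h^2, and \<open>s \<ge> 2 * N\<close>.\<close>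

lemma equal_cube_sums_close_aux:
  fixes a b c e N h :: real
  assumes eq: "a ^ 3 + b ^ 3 = c ^ 3 + e ^ 3" and "N > 0"
    and int: "a \<in> {N..N + h}" "b \<in> {N..N + h}"
    and le: "a + b \<le> c + e"
  shows "(c + e - (a + b)) * (2 * N) \<le> h\<^sup>2"
proof -
  define s t where "s = a + b" and "t = c + e"
  have s: "s \<ge> 2 * N" using int by (simp add: s_def)
  have st: "0 < s" "s \<le> t" using le s \<open>N > 0\<close> by (simp_all add: s_def t_def)
  have "\<bar>a - b\<bar> \<le> h" using int by auto
  then have d: "(a - b)\<^sup>2 \<le> h\<^sup>2" by (metis abs_ge_zero power2_abs power_mono)
  have "t ^ 3 + 3 * t * (c - e)\<^sup>2 = s ^ 3 + 3 * s * (a - b)\<^sup>2"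
    using eq cube_sum_by_sum_and_difference [of a b] cube_sum_by_sum_and_difference [of c e]
    by (simp add: s_def t_def)
  moreover have "3 * t * (c - e)\<^sup>2 \<ge> 0" using st by simp
  moreover have "3 * s * (a - b)\<^sup>2 \<le> 3 * s * h\<^sup>2"
    using st by (intro mult_left_mono d) auto
  moreover have "(t - s) * (3 * (s * s)) \<le> t ^ 3 - s ^ 3"
  proof -
    \<comment> \<open>Each of the three terms in the cofactor of \<open>t - s\<close> in
      \<open>t ^ 3 - s ^ 3\<close> is at least \<open>s * s\<close>.\<close>
    have "s * s \<le> t * s" "s * s \<le> t * t"
      using st by (simp_all add: mult_mono)
    then have "3 * (s * s) \<le> t * t + t * s + s * s" by linarith
    then have "(t - s) * (3 * (s * s)) \<le> (t - s) * (t * t + t * s + s * s)"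
      using st by (intro mult_left_mono) auto
    also have "\<dots> = t ^ 3 - s ^ 3" by (simp add: power3_eq_cube algebra_simps)
    finally show ?thesis .
  qed
  ultimately have "3 * s * ((t - s) * s) \<le> 3 * s * h\<^sup>2"
    by (simp add: mult_ac)
  then have "(t - s) * s \<le> h\<^sup>2" using st by simp
  moreover have "(t - s) * (2 * N) \<le> (t - s) * s"
    using st s by (intro mult_left_mono) auto
  ultimately show ?thesis by (simp add: s_def t_def)
qed

lemma equal_cube_sums_close:
  fixes a b c e N h :: real
  assumes "a ^ 3 + b ^ 3 = c ^ 3 + e ^ 3" "N > 0"
    and "a \<in> {N..N + h}" "b \<in> {N..N + h}" "c \<in> {N..N + h}" "e \<in> {N..N + h}"
  shows "\<bar>a + b - (c + e)\<bar> \<le> h\<^sup>2 / (2 * N)"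
proof -
  have "\<bar>a + b - (c + e)\<bar> * (2 * N) \<le> h\<^sup>2"
    using equal_cube_sums_close_aux [of a b c e N h] equal_cube_sums_close_aux [of c e a b N h] assms
    by (cases "a + b \<le> c + e") auto
  then show ?thesis using \<open>N > 0\<close> by (simp add: field_simps)
qed

text \<open>A positive sum and the sum of cubes determine the square of the difference, hence the
  pair up to order.\<close>

lemma equal_sum_and_cube_sum:
  fixes a b c e :: int
  assumes "a + b = c + e" "a ^ 3 + b ^ 3 = c ^ 3 + e ^ 3" "a + b > 0"
  shows "(c, e) = (a, b) \<or> (c, e) = (b, a)"
proof -
  have "3 * (a + b) * (a - b)\<^sup>2 = 3 * (a + b) * (c - e)\<^sup>2"
    using cube_sum_by_sum_and_difference [of a b] cube_sum_by_sum_and_difference [of c e] assms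
    by simp
  then have "(a - b)\<^sup>2 = (c - e)\<^sup>2" using assms(3) by simp
  then have "a - b = c - e \<or> a - b = - (c - e)" by (simp add: power2_eq_iff)
  then show ?thesis using assms(1) by auto
qed

lemma card_le_mult_card_image:
  assumes "finite P" "\<And>y. y \<in> g ` P \<Longrightarrow> card {x \<in> P. g x = y} \<le> k"
  shows "card P \<le> card (g ` P) * k"
proof -
  have "card P = (\<Sum>y\<in>g ` P. card {x \<in> P. g x = y})"
    using sum.image_gen [OF assms(1), of "\<lambda>_. 1 :: nat" g] by simp
  also have "\<dots> \<le> card (g ` P) * k"
    using sum_bounded_above [of "g ` P" "\<lambda>y. card {x \<in> P. g x = y}" k] assms(2) by simp
  finally show ?thesis .
qed

section \<open>Counting ordered representations\<close>

definition cube_sum_reps :: "nat \<Rightarrow> real \<Rightarrow> int \<Rightarrow> (int \<times> int) set" where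
  "cube_sum_reps N h m = {(a, b). real_of_int a \<in> {real N..real N + h} \<and>
     real_of_int b \<in> {real N..real N + h} \<and> a ^ 3 + b ^ 3 = m}"

lemma finite_cube_sum_reps: "finite (cube_sum_reps N h m)"
proof -
  obtain k where k: "k = \<lfloor>real N + h\<rfloor>" by simp
  have "a \<le> k \<longleftrightarrow> real_of_int a \<le> real N + h" for a
    by (simp only: k le_floor_iff)
  then have "cube_sum_reps N h m \<subseteq> {int N..k} \<times> {int N..k}"
    by (auto simp: cube_sum_reps_def)
  then show ?thesis by (rule finite_subset) simp
qed

text \<open>Four distinct sums would be divisors of \<open>4 * m\<close>, each at least 2 N and
  pairwise within \<open>L\<close>; their product would be at least 16 N^4, but the gcd bound allows
  at most N^4.\<close>

lemma card_cube_sum_reps_sums: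
  assumes "N > 0" "0 \<le> h" "h \<le> real N" "h ^ 12 \<le> real N ^ 7"
  shows "card ((\<lambda>(a, b). a + b) ` cube_sum_reps N h m) \<le> 3"
proof (rule ccontr)
  let ?T = "(\<lambda>(a, b). a + b) ` cube_sum_reps N h m"
  define L where "L = h\<^sup>2 / (2 * real N)"
  assume "\<not> card ?T \<le> 3"
  then have "4 \<le> card ?T" by simp
  then obtain Q where Q: "Q \<subseteq> ?T" "card Q = 4"
    by (rule obtain_subset_with_card_n)
  then obtain x y z w where Qe: "Q = {x, y, z, w}" and dist: "distinct [x, y, z, w]"
    by (auto simp: numeral_eq_Suc card_Suc_eq)
  have close: "\<bar>real_of_int s - t\<bar> \<le> L" if st: "s \<in> ?T" "t \<in> ?T" for s t
  proof -
    obtain a b c e where s: "s = a + b" "t = c + e"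
      and *: "(a, b) \<in> cube_sum_reps N h m" "(c, e) \<in> cube_sum_reps N h m"
      using st by auto
    then have "a ^ 3 + b ^ 3 = c ^ 3 + e ^ 3" by (simp add: cube_sum_reps_def)
    then have "real_of_int (a ^ 3 + b ^ 3) = real_of_int (c ^ 3 + e ^ 3)" by (simp only:)
    then have "\<bar>real_of_int a + real_of_int b - (real_of_int c + real_of_int e)\<bar> \<le> L"
      unfolding L_def using * \<open>N > 0\<close>
      by (intro equal_cube_sums_close) (simp_all add: cube_sum_reps_def)
    then show ?thesis by (simp add: s)
  qed
  have dvd: "s dvd 4 * m" and large: "real_of_int s \<ge> 2 * real N" if sT: "s \<in> ?T" for s
  proof -
    obtain a b where s: "s = a + b" and *: "(a, b) \<in> cube_sum_reps N h m"
      using sT by auto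
    then have "4 * m = s ^ 3 + 3 * s * (a - b)\<^sup>2"
      using cube_sum_by_sum_and_difference [of a b] by (simp add: cube_sum_reps_def)
    then show "s dvd 4 * m" by (simp add: power3_eq_cube)
    show "real_of_int s \<ge> 2 * real N" using * s by (auto simp: cube_sum_reps_def)
  qed
  have Tpos: "s > 0" if "s \<in> ?T" for s
    using large [OF that] \<open>N > 0\<close> by linarith
  have inT: "x \<in> ?T" "y \<in> ?T" "z \<in> ?T" "w \<in> ?T" using Q(1) Qe by auto
  obtain a b where ab: "(a, b) \<in> cube_sum_reps N h m" using inT(1) by auto
  have m_eq: "m = a ^ 3 + b ^ 3" using ab by (simp add: cube_sum_reps_def)
  have ab_bounds: "real N \<le> a" "real_of_int a \<le> 2 * real N" "real N \<le> b" "real_of_int b \<le> 2 * real N"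
    using ab \<open>h \<le> real N\<close> by (auto simp: cube_sum_reps_def)
  have "a > 0" "b > 0" using ab_bounds \<open>N > 0\<close> by linarith+
  then have m0: "4 * m > 0" by (simp add: m_eq add_pos_pos)
  have "real_of_int a ^ 3 \<le> (2 * real N) ^ 3" "real_of_int b ^ 3 \<le> (2 * real N) ^ 3"
    using ab_bounds \<open>a > 0\<close> \<open>b > 0\<close> power_mono [of "real_of_int a" "2 * real N" 3]
      power_mono [of "real_of_int b" "2 * real N" 3] by linarith+
  \<comment> \<open>Both bases are at most 2 N because \<open>h \<le> real N\<close>, so 4 (8 N^3 +
    8 N^3) bounds \<open>4 * m\<close>.\<close>
  then have m_le: "real_of_int (4 * m) \<le> 64 * real N ^ 3"
    by (simp add: m_eq power_mult_distrib)
  \<comment> \<open>Here the hypothesis on \<open>h ^ 12\<close> enters; the 64 cancels against the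
    one bounding \<open>4 * m\<close>.\<close>
  have "L ^ 6 = h ^ 12 / (64 * real N ^ 6)"
    by (simp add: L_def power_divide power_mult_distrib flip: power_mult)
  also have "\<dots> \<le> real N ^ 7 / (64 * real N ^ 6)"
    using assms(4) by (intro divide_right_mono) auto
  also have "\<dots> = real N / 64"
    using \<open>N > 0\<close> by (simp add: field_simps power_numeral_reduce)
  finally have L6: "L ^ 6 \<le> real N / 64" .
  have "(2 * real N) * (2 * real N) * (2 * real N) * (2 * real N) \<le> real_of_int x * y * z * w"
    using large [OF inT(1)] large [OF inT(2)] large [OF inT(3)] large [OF inT(4)] Tpos inT
    by (intro mult_mono mult_nonneg_nonneg) (auto simp: less_imp_le)
  also have "\<dots> = real_of_int (x * y * z * w)" by simp
  also have "\<dots> \<le> real_of_int (4 * m) * L ^ 6"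
    using inT by (intro four_divisors_close_bound dvd m0 Tpos dist close) auto
  also have "\<dots> \<le> (64 * real N ^ 3) * (real N / 64)"
    using m_le L6 by (intro mult_mono) (auto simp: L_def)
  also have "\<dots> = real N ^ 4" by (simp add: power_numeral_reduce)
  finally have "16 * real N ^ 4 \<le> real N ^ 4" by (simp add: power_numeral_reduce)
  moreover have "real N ^ 4 > 0" using \<open>N > 0\<close> by simp
  ultimately show False by linarith
qed

text \<open>There are at most three values of \<open>a + b\<close>, and each comes from at most two
  ordered pairs, a pair and its swap.\<close>

lemma card_cube_sum_reps:
  assumes "N > 0" "0 \<le> h" "h \<le> real N" "h ^ 12 \<le> real N ^ 7"
  shows "card (cube_sum_reps N h m) \<le> 6"
proof -
  let ?P = "cube_sum_reps N h m" and ?g = "\<lambda>(a :: int, b). a + b"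
  have "card ?P \<le> card (?g ` ?P) * 2"
  proof (rule card_le_mult_card_image [OF finite_cube_sum_reps])
    fix s
    assume "s \<in> ?g ` ?P"
    then obtain a b where ab: "(a, b) \<in> ?P" "s = a + b" by auto
    then have "real N \<le> a" "real N \<le> b" by (auto simp: cube_sum_reps_def)
    then have "a + b > 0" using \<open>N > 0\<close> by linarith
    have "(c, e) \<in> {(a, b), (b, a)}" if "(c, e) \<in> ?P" "c + e = s" for c e
    proof -
      have "a ^ 3 + b ^ 3 = m" "c ^ 3 + e ^ 3 = m"
        using that(1) ab(1) by (simp_all only: cube_sum_reps_def mem_Collect_eq case_prod_conv)
      then have "(c, e) = (a, b) \<or> (c, e) = (b, a)"
        using that(2) ab(2) by (intro equal_sum_and_cube_sum \<open>a + b > 0\<close>) (simp_all only:)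
      then show ?thesis by blast
    qed
    then have "{p \<in> ?P. ?g p = s} \<subseteq> {(a, b), (b, a)}" by fast
    then have "card {p \<in> ?P. ?g p = s} \<le> card {(a, b), (b, a)}"
      by (intro card_mono) auto
    also have "\<dots> \<le> 2" by (intro card_insert_le_m1) simp_all
    finally show "card {p \<in> ?P. ?g p = s} \<le> 2" .
  qed
  then show ?thesis using card_cube_sum_reps_sums [OF assms, of m] by simp
qed

section \<open>The exponent and the final estimate\<close>

lemma gamma1_less: "gamma1 < 7/12"
proof -
  \<comment> \<open>The value 25/6 solves (x - 3) / 2 = 7/12, and its square 625/36 exceeds
    17.\<close>
  have "sqrt 17 < 25/6" by (rule real_less_lsqrt) (auto simp: power2_eq_square)
  then show ?thesis by (simp add: gamma1_def)
qed

lemma card_short_cubes_reps: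
  assumes "N > 0" "\<epsilon> > 0"
  shows "card {(u, v) \<in> short_cubes N \<epsilon> \<times> short_cubes N \<epsilon>. u + v = m} \<le> 6"
proof -
  define h where "h = real N powr (gamma1 - \<epsilon>)"
  have N1: "real N \<ge> 1" using \<open>N > 0\<close> by simp
  have h_le: "h \<le> real N powr (7/12)"
    unfolding h_def using gamma1_less \<open>\<epsilon> > 0\<close> N1 by (intro powr_mono) auto
  also have "\<dots> \<le> real N powr 1" using N1 by (intro powr_mono) auto
  finally have hN: "h \<le> real N" by simp
  have h0: "h \<ge> 0" by (simp add: h_def)
  \<comment> \<open>The exponent 7/12 is exactly what the condition on \<open>h ^ 12\<close>
    permits.\<close>
  have "h ^ 12 \<le> (real N powr (7/12)) ^ 12" using h_le h0 by (rule power_mono)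
  also have "\<dots> = real N powr 7"
    using N1 by (simp add: powr_powr flip: powr_numeral)
  finally have h12: "h ^ 12 \<le> real N ^ 7" by simp
  \<comment> \<open>Frequencies are the cubes themselves, so pairs of frequencies are images of
    pairs of bases under cubing.\<close>
  have "{(u, v) \<in> short_cubes N \<epsilon> \<times> short_cubes N \<epsilon>. u + v = m}
      \<subseteq> (\<lambda>(a, b). (a ^ 3, b ^ 3)) ` cube_sum_reps N h m"
    by (auto simp: short_cubes_def cube_sum_reps_def h_def image_iff)
  then have "card {(u, v) \<in> short_cubes N \<epsilon> \<times> short_cubes N \<epsilon>. u + v = m}
      \<le> card (cube_sum_reps N h m)"
    by (rule surj_card_le [OF finite_cube_sum_reps])
  also have "\<dots> \<le> 6" by (rule card_cube_sum_reps [OF \<open>N > 0\<close> h0 hN h12])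
  finally show ?thesis .
qed

(* The bound is stated for 0 < \<epsilon> \<le> 1: with an absolute C it cannot hold for arbitrarily
   large \<epsilon>, since a single exponential has both norms equal to 1 while
   C * \<epsilon> powr (-1/4) tends to 0 as \<epsilon> grows. Since gamma1 < 1, every \<epsilon> for which
   the exponent gamma1 - \<epsilon> is nonnegative is covered. *)
theorem theorem1p8:
  "\<exists>C > 0. \<forall>\<epsilon> :: real. \<forall>N :: nat. \<forall>f :: real \<Rightarrow> complex.
     0 < \<epsilon> \<longrightarrow> \<epsilon> \<le> 1 \<longrightarrow> 0 < N \<longrightarrow> trig_poly_on (short_cubes N \<epsilon>) f \<longrightarrow>
       Lp_norm_circle 4 f \<le> C * \<epsilon> powr (-1/4) * Lp_norm_circle 2 f"
proof (intro exI [of _ "6 powr (1/4)"] conjI allI impI)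
  fix \<epsilon> :: real and N :: nat and f :: "real \<Rightarrow> complex"
  assume *: "0 < \<epsilon>" "\<epsilon> \<le> 1" "0 < N" "trig_poly_on (short_cubes N \<epsilon>) f"
  \<comment> \<open>For \<open>\<epsilon> \<le> 1\<close> the factor
    \<open>\<epsilon> powr (-1/4)\<close> is at least 1, so the uniform bound with constant
    \<open>6 powr (1/4)\<close> implies the stated one.\<close>
  have "\<epsilon> powr (-1/4) \<ge> \<epsilon> powr 0"
    using * by (intro powr_mono') auto
  then have e: "1 \<le> \<epsilon> powr (-1/4)" using * by simp
  have "Lp_norm_circle 4 f \<le> real 6 powr (1/4) * Lp_norm_circle 2 f"
    by (rule L4_le_L2_of_representation_bound [OF *(4) card_short_cubes_reps [OF *(3,1)]])
  also have "\<dots> = 6 powr (1/4) * 1 * Lp_norm_circle 2 f" by simp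
  also have "\<dots> \<le> 6 powr (1/4) * \<epsilon> powr (-1/4) * Lp_norm_circle 2 f"
    using e by (intro mult_right_mono mult_left_mono) (simp_all add: Lp_norm_circle_def)
  finally show "Lp_norm_circle 4 f \<le> 6 powr (1/4) * \<epsilon> powr (-1/4) * Lp_norm_circle 2 f" .
qed simp

end
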